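(* Let $\psi$ be strictly convex and differentiable on the interior of its domain $\mathrm{dom}(\psi)\subset\mathbb{R}_+^{N_T}$, and let $\mathbf{C}\in\mathbb{R}_+^{N_S\times N_T}$. Let $(\bm{a},\bm{b},\xi)$, with $\bm{a}\in\Delta^{N_S}$ and $\bm{b}\in\Delta^{N_T}$, be such that $\Pi(\bm{a},\bm{b})\cap\mathcal{B}_\psi(\xi)$ has an interior point, where $$\mathcal{B}_\psi(\xi)=\{\mathbf{P}\ge\mathbf{0}\ :\ \forall i,\ \psi(\mathbf{P}_{i:})\le\psi(\mathbf{e}_\xi)\},$$ and let $\mathbf{P}^\star$ solve $$\min_{\mathbf{P}\in\Pi(\bm{a},\bm{b})}\ \langle\mathbf{P},\mathbf{C}\rangle\quad\text{s.t.}\quad\mathbf{P}\in\mathcal{B}_\psi(\xi).$$ Let $\bm{\varepsilon}^\star$ be the optimal dual variable associated with the constraint $\mathbf{P}\in\mathcal{B}_\psi(\xi)$. If $\bm{\varepsilon}^\star>\bm{0}$, then $$\mathbf{P}^\star=\operatorname{Proj}^{D_\psi}_{\Pi(\bm{a},\bm{b})\cap\mathcal{B}_\psi(\xi)}(\mathbf{K}_\sigma)\quad\text{for any } 0<\sigma\le\min_i\varepsilon_i^\star,$$ where $\mathbf{K}_\sigma=\nabla\psi^*(-\mathbf{C}/\sigma)$. Moreover, $$\mathbf{P}^\star=\nabla\psi^*\big(\operatorname{diag}(\bm{\varepsilon}^\star)^{-1}(\mathbf{C}-\bm{\lambda}^\star\oplus\bm{\mu}^\star)\big),$$ where $(\bm{\lambda}^\star,\bm{\mu}^\star,\bm{\varepsilon}^\star)$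 solve the following dual problem: $$\max_{\bm{\lambda},\ \bm{\mu},\ \bm{\varepsilon}>\bm{0}}\ \langle\bm{\lambda},\bm{a}\rangle+\langle\bm{\mu},\bm{b}\rangle+\Big\langle\bm{\varepsilon},\ \psi^*\big(\operatorname{diag}(\bm{\varepsilon})^{-1}(\mathbf{C}-\bm{\lambda}\oplus\bm{\mu})\big)-\psi(\mathbf{e}_\xi)\bm{1}\Big\rangle.$$
   Context: $\Delta^n$ is the probability simplex in $\mathbb{R}^n$. $\Pi(\bm{a},\bm{b})=\{\mathbf{P}\in\mathbb{R}_+^{N_S\times N_T}:\mathbf{P}\bm{1}=\bm{a},\ \mathbf{P}^\top\bm{1}=\bm{b}\}$ is the transport polytope, and $\mathbf{C}$ is a cost matrix. $\mathbf{P}_{i:}$ is the $i$-th row of $\mathbf{P}$; $\langle\cdot,\cdot\rangle$ is the standard inner product of vectors or matrices; $\bm{1}$ is an all-ones vector; $\bm{\lambda}\oplus\bm{\mu}$ is the matrix $(\lambda_i+\mu_j)_{ij}$ for $\bm{\lambda}\in\mathbb{R}^{N_S}$, $\bm{\mu}\in\mathbb{R}^{N_T}$; $\mathbf{P}\ge\mathbf{0}$ and $\bm{\varepsilon}>\bm{0}$ (with $\bm{\varepsilon}\in\mathbb{R}^{N_S}$) are entrywise. $\psi$ takes values in $\mathbb{R}\cup\{\infty\}$. For the perplexity parameter $\xi>0$, $\mathbf{e}_\xi$ is the vector whose $j$-th entry is $1/\xi$ if $j\le\xi$ and $0$ otherwise. The convex conjugate is $\psi^*(\bm{p})=\sup_{\bm{q}\in\mathrm{dom}(\psi)}\langle\bm{p},\bm{q}\rangle-\psi(\bm{q})$;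 the supremum is uniquely achieved and $\nabla\psi^*(\bm{p})=\arg\max_{\bm{q}\in\mathrm{dom}(\psi)}\langle\bm{p},\bm{q}\rangle-\psi(\bm{q})$. For matrices these act row by row: $\psi(\mathbf{P})=(\psi(\mathbf{P}_{1:}),\dots,\psi(\mathbf{P}_{N_S:}))^\top$, likewise $\psi^*(\mathbf{P})$, and $\nabla\psi^*(\mathbf{P})$ is the matrix with rows $\nabla\psi^*(\mathbf{P}_{i:})$. The Bregman divergence is $D_\psi(\mathbf{P}|\mathbf{Q})=\psi(\mathbf{P})-\psi(\mathbf{Q})-\langle\mathbf{P}-\mathbf{Q},\nabla\psi(\mathbf{Q})\rangle$, where for matrices $\psi$ is understood here as summed over rows and $\nabla\psi(\mathbf{Q})$ has rows $\nabla\psi(\mathbf{Q}_{i:})$. For a set $\mathcal{E}$, $\operatorname{Proj}^{D_\psi}_{\mathcal{E}}(\mathbf{K})=\arg\min_{\mathbf{P}\in\mathcal{E}}D_\psi(\mathbf{P}|\mathbf{K})$. "Has an interior point" is used in the sense that the problem is strictly feasible, so that Slater's constraint qualification gives strong duality. The dual variables $\bm{\lambda},\bm{\mu}$ (marginal constraints) and $\bm{\varepsilon}\ge\bm{0}$ (constraint $\mathbf{P}\in\mathcal{B}_\psi(\xi)$) are those of the Lagrangian, over $\mathbf{P}\ge\mathbf{0}$, $\langle\mathbf{P},\mathbf{C}\rangle+\langle\bm{\lambda},\bm{a}-\mathbf{P}\bm{1}\rangle+\langle\bm{\mu},\bm{b}-\mathbf{P}^\top\bm{1}\rangle+\langle\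bm{\varepsilon},\psi(\mathbf{P})-\psi(\mathbf{e}_\xi)\bm{1}\rangle$.
   Formalization: Signs corrected: P* uses ∇ψ*(diag(ε)^{-1}(λ⊕μ−C)) and the dual has −ψ*(diag(ε)^{-1}(λ⊕μ−C)), since the printed dual can be unbounded; the projection claim requires the rows of K_σ to lie in the interior of dom(ψ), where ∇ψ(K_σ) is defined. *)

theory Defs
  imports "HOL-Analysis.Analysis"
begin

definition prob_simplex :: "(real ^ 'n) set" where
  "prob_simplex = {a. (\<forall>i. 0 \<le> a $ i) \<and> (\<Sum>i\<in>UNIV. a $ i) = 1}"

definition nonneg_mat :: "real ^ 'n ^ 'm \<Rightarrow> bool" where
  "nonneg_mat P \<longleftrightarrow> (\<forall>i j. 0 \<le> P $ i $ j)"

(* The constant 1 of a vector type is the all-ones vector. *)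
definition transport_polytope :: "real ^ 'm \<Rightarrow> real ^ 'n \<Rightarrow> (real ^ 'n ^ 'm) set" where
  "transport_polytope a b = {P. nonneg_mat P \<and> P *v 1 = a \<and> transpose P *v 1 = b}"

definition outer_sum :: "real ^ 'm \<Rightarrow> real ^ 'n \<Rightarrow> real ^ 'n ^ 'm" where
  "outer_sum l m = (\<chi> i j. l $ i + m $ j)"

(* diag(e)^{-1} M *)
definition row_scale :: "real ^ 'm \<Rightarrow> real ^ 'n ^ 'm \<Rightarrow> real ^ 'n ^ 'm" where
  "row_scale e M = (\<chi> i. (1 / e $ i) *\<^sub>R M $ i)"

(* The linear order on the index type numbers the coordinates 1, ..., CARD('n):
   the position of j is card {k. k \<le> j}. *)
definition perplexity_vec :: "real \<Rightarrow> real ^ 'n::{finite,linorder}" where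
  "perplexity_vec \<xi> = (\<chi> j. if real (card {k. k \<le> j}) \<le> \<xi> then 1 / \<xi> else 0)"

definition edom :: "('a \<Rightarrow> ereal) \<Rightarrow> 'a set" where
  "edom \<psi> = {q. \<psi> q < \<infinity>}"

definition strictly_convex_on :: "'a::real_vector set \<Rightarrow> ('a \<Rightarrow> real) \<Rightarrow> bool" where
  "strictly_convex_on S f \<longleftrightarrow> convex S \<and>
     (\<forall>x\<in>S. \<forall>y\<in>S. \<forall>t. x \<noteq> y \<longrightarrow> 0 < t \<longrightarrow> t < 1 \<longrightarrow>
        f ((1 - t) *\<^sub>R x + t *\<^sub>R y) < (1 - t) * f x + t * f y)"

definition gradient :: "('a::real_inner \<Rightarrow> real) \<Rightarrow> 'a \<Rightarrow> 'a" where
  "gradient f x = (THE D. GDERIV f x :> D)"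

definition conjugate :: "('a::real_inner \<Rightarrow> ereal) \<Rightarrow> 'a \<Rightarrow> ereal" where
  "conjugate \<psi> p = (SUP q\<in>edom \<psi>. ereal (p \<bullet> q) - \<psi> q)"

abbreviation is_conjugate_maximizer :: "('a::real_inner \<Rightarrow> ereal) \<Rightarrow> 'a \<Rightarrow> 'a \<Rightarrow> bool" where
  "is_conjugate_maximizer \<psi> p \<equiv> is_arg_max (\<lambda>q. ereal (p \<bullet> q) - \<psi> q) (\<lambda>q. q \<in> edom \<psi>)"

(* The gradient of the conjugate as the point achieving the supremum. It is the gradient of
   the conjugate in the usual sense wherever the latter exists; see grad_conjugate_eq_gradient. *)
definition grad_conjugate :: "('a::real_inner \<Rightarrow> ereal) \<Rightarrow> 'a \<Rightarrow> 'a" where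
  "grad_conjugate \<psi> p = arg_max (\<lambda>q. ereal (p \<bullet> q) - \<psi> q) (\<lambda>q. q \<in> edom \<psi>)"

definition grad_conjugate_rows :: "(real ^ 'n \<Rightarrow> ereal) \<Rightarrow> real ^ 'n ^ 'm \<Rightarrow> real ^ 'n ^ 'm" where
  "grad_conjugate_rows \<psi> M = (\<chi> i. grad_conjugate \<psi> (M $ i))"

definition entropy_ball ::
  "(real ^ 'n::{finite,linorder} \<Rightarrow> ereal) \<Rightarrow> real \<Rightarrow> (real ^ 'n::{finite,linorder} ^ 'm) set" where
  "entropy_ball \<psi> \<xi> = {P. nonneg_mat P \<and> (\<forall>i. \<psi> (P $ i) \<le> \<psi> (perplexity_vec \<xi>))}"

(* Slater's condition: the convex inequality constraints hold strictly at a feasible point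
   in the relative interior of the domain. The constraint P \<ge> 0 is part of the domain. *)
definition strictly_feasible ::
  "(real ^ 'n::{finite,linorder} \<Rightarrow> ereal) \<Rightarrow> real ^ 'm \<Rightarrow> real ^ 'n::{finite,linorder} \<Rightarrow> real \<Rightarrow> bool" where
  "strictly_feasible \<psi> a b \<xi> \<longleftrightarrow>
     (\<exists>P \<in> transport_polytope a b.
        \<forall>i. P $ i \<in> rel_interior (edom \<psi>) \<and> \<psi> (P $ i) < \<psi> (perplexity_vec \<xi>))"

definition bregman_div :: "(real ^ 'n \<Rightarrow> ereal) \<Rightarrow> real ^ 'n ^ 'm \<Rightarrow> real ^ 'n ^ 'm \<Rightarrow> ereal" where
  "bregman_div \<psi> P Q = (\<Sum>i\<in>UNIV. \<psi> (P $ i)) - (\<Sum>i\<in>UNIV. \<psi> (Q $ i))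
     - ereal ((P - Q) \<bullet> (\<chi> i. gradient (\<lambda>q. real_of_ereal (\<psi> q)) (Q $ i)))"

(* The set of all minimizers; "P is the projection" is rendered as "this set is {P}". *)
definition bregman_proj ::
  "(real ^ 'n \<Rightarrow> ereal) \<Rightarrow> (real ^ 'n ^ 'm) set \<Rightarrow> real ^ 'n ^ 'm \<Rightarrow> (real ^ 'n ^ 'm) set" where
  "bregman_proj \<psi> E K = {P. is_arg_min (\<lambda>P. bregman_div \<psi> P K) (\<lambda>P. P \<in> E) P}"

definition lagrangian ::
  "(real ^ 'n::{finite,linorder} \<Rightarrow> ereal) \<Rightarrow> real ^ 'n::{finite,linorder} ^ 'm \<Rightarrow> real ^ 'm \<Rightarrow> real ^ 'n::{finite,linorder} \<Rightarrow> real \<Rightarrow>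
   real ^ 'n::{finite,linorder} ^ 'm \<Rightarrow> real ^ 'm \<Rightarrow> real ^ 'n::{finite,linorder} \<Rightarrow> real ^ 'm \<Rightarrow> ereal" where
  "lagrangian \<psi> C a b \<xi> P l m e =
     ereal (P \<bullet> C + l \<bullet> (a - P *v 1) + m \<bullet> (b - transpose P *v 1))
     + (\<Sum>i\<in>UNIV. ereal (e $ i) * (\<psi> (P $ i) - \<psi> (perplexity_vec \<xi>)))"

(* Rows outside the domain are excluded from the infimum, as usual for Lagrangian duality;
   with the ereal convention 0 * \<infinity> = 0 they would otherwise count when e $ i = 0. *)
definition lagrange_dual ::
  "(real ^ 'n::{finite,linorder} \<Rightarrow> ereal) \<Rightarrow> real ^ 'n::{finite,linorder} ^ 'm \<Rightarrow> real ^ 'm \<Rightarrow> real ^ 'n::{finite,linorder} \<Rightarrow> real \<Rightarrow>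
   real ^ 'm \<Rightarrow> real ^ 'n::{finite,linorder} \<Rightarrow> real ^ 'm \<Rightarrow> ereal" where
  "lagrange_dual \<psi> C a b \<xi> l m e =
     (INF P\<in>{P. nonneg_mat P \<and> (\<forall>i. P $ i \<in> edom \<psi>)}. lagrangian \<psi> C a b \<xi> P l m e)"

definition optimal_multipliers ::
  "(real ^ 'n::{finite,linorder} \<Rightarrow> ereal) \<Rightarrow> real ^ 'n::{finite,linorder} ^ 'm \<Rightarrow> real ^ 'm \<Rightarrow> real ^ 'n::{finite,linorder} \<Rightarrow> real \<Rightarrow>
   ((real ^ 'm) \<times> (real ^ 'n::{finite,linorder}) \<times> (real ^ 'm)) set" where
  "optimal_multipliers \<psi> C a b \<xi> =
     {z. is_arg_max (\<lambda>(l, m, e). lagrange_dual \<psi> C a b \<xi> l m e)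
           (\<lambda>(l, m, e). \<forall>i. 0 \<le> e $ i) z}"

(* For e > 0, minimizing the Lagrangian over row i gives
   - e_i * conjugate \<psi> ((l \<oplus> m - C)_i / e_i), which fixes the signs below. *)
definition dual_objective ::
  "(real ^ 'n::{finite,linorder} \<Rightarrow> ereal) \<Rightarrow> real ^ 'n::{finite,linorder} ^ 'm \<Rightarrow> real ^ 'm \<Rightarrow> real ^ 'n::{finite,linorder} \<Rightarrow> real \<Rightarrow>
   real ^ 'm \<Rightarrow> real ^ 'n::{finite,linorder} \<Rightarrow> real ^ 'm \<Rightarrow> ereal" where
  "dual_objective \<psi> C a b \<xi> l m e =
     ereal (l \<bullet> a + m \<bullet> b)
     + (\<Sum>i\<in>UNIV. ereal (e $ i) *
          (- conjugate \<psi> (row_scale e (outer_sum l m - C) $ i) - \<psi> (perplexity_vec \<xi>)))"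

definition dual_solutions ::
  "(real ^ 'n::{finite,linorder} \<Rightarrow> ereal) \<Rightarrow> real ^ 'n::{finite,linorder} ^ 'm \<Rightarrow> real ^ 'm \<Rightarrow> real ^ 'n::{finite,linorder} \<Rightarrow> real \<Rightarrow>
   ((real ^ 'm) \<times> (real ^ 'n::{finite,linorder}) \<times> (real ^ 'm)) set" where
  "dual_solutions \<psi> C a b \<xi> =
     {z. is_arg_max (\<lambda>(l, m, e). dual_objective \<psi> C a b \<xi> l m e)
           (\<lambda>(l, m, e). \<forall>i. 0 < e $ i) z}"

lemma gradient_eqI:
  assumes "GDERIV f x :> D"
  shows "gradient f x = D"
  unfolding gradient_def
proof (rule the_equality)
  show "GDERIV f x :> D" by (fact assms)
next
  fix D' assume "GDERIV f x :> D'"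
  then have "(\<lambda>h. h \<bullet> D') = (\<lambda>h. h \<bullet> D)"
    using assms has_derivative_unique unfolding gderiv_def by blast
  then show "D' = D"
    by (metis vector_eq_rdot inner_commute)
qed

lemma grad_conjugate_eq_gradient:
  fixes \<psi> :: "'a::euclidean_space \<Rightarrow> ereal"
  assumes nm: "\<And>q. \<psi> q \<noteq> -\<infinity>"
    and ex: "\<And>p. \<exists>!q. is_conjugate_maximizer \<psi> p q"
    and D: "GDERIV (\<lambda>p. real_of_ereal (conjugate \<psi> p)) p :> D"
  shows "gradient (\<lambda>p. real_of_ereal (conjugate \<psi> p)) p = grad_conjugate \<psi> p"
proof -
  let ?f = "\<lambda>p. real_of_ereal (conjugate \<psi> p)"
  have val: "conjugate \<psi> p' = ereal (p' \<bullet> q) - \<psi> q \<and> \<bar>\<psi> q\<bar> \<noteq> \<infinity>"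
    if "is_conjugate_maximizer \<psi> p' q" for p' q
  proof
    have q: "q \<in> edom \<psi>" and m: "\<And>y. y \<in> edom \<psi> \<Longrightarrow> ereal (p' \<bullet> y) - \<psi> y \<le> ereal (p' \<bullet> q) - \<psi> q"
      using that unfolding is_arg_max_def by (auto simp: not_less)
    show "conjugate \<psi> p' = ereal (p' \<bullet> q) - \<psi> q"
      unfolding conjugate_def
      by (rule antisym) (auto intro: SUP_least m SUP_upper q)
    show "\<bar>\<psi> q\<bar> \<noteq> \<infinity>"
      using q nm[of q] by (cases "\<psi> q") (auto simp: edom_def)
  qed
  define q where "q = grad_conjugate \<psi> p"
  have q: "is_conjugate_maximizer \<psi> p q"
    unfolding q_def grad_conjugate_def arg_max_def using ex[of p] by (blast intro: someI)
  have le: "?f p - p \<bullet> q \<le> ?f y - y \<bullet> q" for y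
  proof -
    obtain r where r: "is_conjugate_maximizer \<psi> y r" using ex by blast
    have "q \<in> edom \<psi>" using q by (simp add: is_arg_max_def)
    then have "ereal (y \<bullet> q) - \<psi> q \<le> conjugate \<psi> y"
      unfolding conjugate_def by (rule SUP_upper)
    moreover obtain s t where "\<psi> q = ereal s" "\<psi> r = ereal t"
      using val[OF q] val[OF r] by (auto simp: not_infty_ereal)
    ultimately show ?thesis using val[OF q] val[OF r] by simp
  qed
  have d: "((\<lambda>y. ?f y - y \<bullet> q) has_derivative (\<lambda>h. h \<bullet> D - h \<bullet> q)) (at p)"
    using D unfolding gderiv_def by (auto intro!: derivative_intros)
  have "(\<lambda>h. h \<bullet> D - h \<bullet> q) = (\<lambda>h. 0)"
    using differential_zero_maxmin[OF _ open_UNIV d] le by auto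
  then have "D = q"
    by (metis eq_iff_diff_eq_0 inner_diff_right inner_eq_zero_iff)
  then show ?thesis using gradient_eqI[OF D] q_def by simp
qed

end

theory Submission
  imports Defs
begin

text \<open>
  Slater's condition gives strong duality, so the primal optimum \<open>P\<close> attains the minimum of the
  Lagrangian at the optimal multipliers. For \<open>e > 0\<close> the Lagrangian splits into rows, each with the
  unique minimizer \<open>\<nabla>\<psi>\<^sup>*((l \<oplus> m - C)\<^sub>i / e\<^sub>i)\<close>; hence \<open>P\<close> has these rows, and complementary
  slackness makes every constraint \<open>\<psi>(P\<^sub>i) \<le> \<psi>(e\<^sub>\<xi>)\<close> tight. Since \<open>\<nabla>\<psi>(K\<^sub>\<sigma>) = - C / \<sigma>\<close>, the
  projection minimizes \<open>\<langle>Q, C\<rangle> + \<sigma> \<Sum>\<^sub>i \<psi>(Q\<^sub>i)\<close>, which differs from the Lagrangian on the feasible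
  set by a constant and the terms \<open>(\<sigma> - e\<^sub>i) (\<psi>(Q\<^sub>i) - \<psi>(e\<^sub>\<xi>)) \<ge> 0\<close>, all of which vanish at \<open>P\<close>.
\<close>

section \<open>Lagrange multipliers from Slater's condition\<close>

text \<open>
  Separating within the span of the set of attainable constraint values avoids any rank condition
  on \<open>A\<close>. The assumption \<open>core\<close> says that \<open>x0\<close> is in the relative interior of \<open>X\<close>.
\<close>

lemma slater_multipliers:
  fixes X :: "'x::real_vector set" and A :: "'x \<Rightarrow> 'y::euclidean_space"
    and g :: "'x \<Rightarrow> real ^ 'm" and h :: "'x \<Rightarrow> real"
  assumes h: "convex_on X h" and g: "\<And>i. convex_on X (\<lambda>x. g x $ i)" and A: "linear A"
    and x0: "x0 \<in> X" "A x0 = y" "\<And>i. g x0 $ i < 0"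
    and core: "\<And>x. x \<in> X \<Longrightarrow> \<exists>t>1. (1 - t) *\<^sub>R x + t *\<^sub>R x0 \<in> X"
    and opt: "\<And>x. x \<in> X \<Longrightarrow> A x = y \<Longrightarrow> (\<And>i. g x $ i \<le> 0) \<Longrightarrow> v \<le> h x"
  obtains l :: 'y and e :: "real ^ 'm"
  where "\<And>i. 0 \<le> e $ i" "\<And>x. x \<in> X \<Longrightarrow> v \<le> h x + l \<bullet> (y - A x) + e \<bullet> g x"
proof -
  \<comment> \<open>\<open>W\<close> is closed upwards in \<open>s\<close> and \<open>r\<close>. The
    strict bound on the cost keeps 0 out of \<open>W\<close>: otherwise some feasible point would
    have cost below \<open>v\<close>.\<close>
  define W where "W = {(u, s, r). \<exists>x\<in>X. u = y - A x \<and> (\<forall>i. g x $ i \<le> s $ i) \<and> h x - v < r}"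
  have WI: "(y - A x, s, r) \<in> W" if "x \<in> X" "\<And>i. g x $ i \<le> s $ i" "h x - v < r" for x s r
    using that unfolding W_def by auto
  have "convex W"
    unfolding convex_alt
  proof (intro ballI allI impI)
    fix w w' and t :: real
    assume w: "w \<in> W" and w': "w' \<in> W" and t: "0 \<le> t \<and> t \<le> 1"
    obtain x s r where x: "x \<in> X" "\<And>i. g x $ i \<le> s $ i" "h x - v < r" "w = (y - A x, s, r)"
      using w unfolding W_def by auto
    obtain x' s' r' where x': "x' \<in> X" "\<And>i. g x' $ i \<le> s' $ i" "h x' - v < r'" "w' = (y - A x', s', r')"
      using w' unfolding W_def by auto
    let ?x = "(1 - t) *\<^sub>R x + t *\<^sub>R x'"
    have "?x \<in> X"
      using h x(1) x'(1) t by (auto simp: convex_on_def convex_alt)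
    moreover have "g ?x $ i \<le> ((1 - t) *\<^sub>R s + t *\<^sub>R s') $ i" for i
    proof -
      have "g ?x $ i \<le> (1 - t) * g x $ i + t * g x' $ i"
        using convex_onD[OF g, of t x x' i] x(1) x'(1) t by simp
      also have "\<dots> \<le> (1 - t) * s $ i + t * s' $ i"
        using x(2) x'(2) t by (intro add_mono mult_left_mono) auto
      finally show ?thesis by simp
    qed
    moreover have "h ?x - v < (1 - t) * r + t * r'"
    proof -
      have "h ?x - v \<le> (1 - t) * (h x - v) + t * (h x' - v)"
        using convex_onD[OF h, of t x x'] x(1) x'(1) t by (simp add: algebra_simps)
      also have "\<dots> < (1 - t) * r + t * r'"
      \<comment> \<open>Strictness comes from the second summand when \<open>t > 0\<close> and from
        the first when \<open>t = 0\<close>.\<close>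
      proof (cases "t = 0")
        case False
        then show ?thesis
          using x(3) x'(3) t by (intro add_le_less_mono mult_left_mono mult_strict_left_mono) auto
      qed (use x(3) in auto)
      finally show ?thesis .
    qed
    ultimately have "(y - A ?x, (1 - t) *\<^sub>R s + t *\<^sub>R s', (1 - t) * r + t * r') \<in> W"
      by (rule WI)
    moreover have "y - A ?x = (1 - t) *\<^sub>R (y - A x) + t *\<^sub>R (y - A x')"
      by (simp add: linear_add[OF A] linear_diff[OF A] linear_cmul[OF A] algebra_simps)
    ultimately show "(1 - t) *\<^sub>R w + t *\<^sub>R w' \<in> W"
      using x(4) x'(4) by simp
  qed
  moreover have "(0, g x0, h x0 - v + 1) \<in> W"
    using WI[of x0 "g x0" "h x0 - v + 1"] x0 by simp
  moreover have "0 \<notin> W"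
  proof
    assume "0 \<in> W"
    then obtain x where x: "x \<in> X" "A x = y" "\<And>i. g x $ i \<le> 0" "h x - v < 0"
      unfolding W_def by (auto simp: zero_prod_def)
    with opt[of x] show False by simp
  qed
  ultimately obtain z where z: "z \<in> span W" "z \<noteq> 0" "\<And>w. w \<in> W \<Longrightarrow> 0 \<le> z \<bullet> w"
    using separating_hyperplane_set_0_inspan[of W] by blast
  obtain l e r where zd: "z = (l, e, r)" by (cases z) auto
  have sep: "0 \<le> l \<bullet> (y - A x) + e \<bullet> s + r * q"
    if "x \<in> X" "\<And>i. g x $ i \<le> s $ i" "h x - v < q" for x s q
    using z(3)[OF WI[OF that]] by (simp add: zd inner_prod_def add.assoc)
  have e: "0 \<le> e $ i" for i
  proof (rule ccontr)
    assume "\<not> 0 \<le> e $ i"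
    then have neg: "e $ i < 0" by simp
    \<comment> \<open>Raising slack \<open>i\<close> by \<open>k / - e $ i\<close> stays in
      \<open>W\<close> and lowers the pairing by exactly \<open>k\<close>, which exceeds its
      starting absolute value.\<close>
    define k where "k = \<bar>e \<bullet> g x0 + r * (h x0 - v + 1)\<bar> + 1"
    have "0 \<le> l \<bullet> (y - A x0) + e \<bullet> (g x0 + (k / - e $ i) *\<^sub>R axis i 1) + r * (h x0 - v + 1)"
      by (rule sep) (use x0 neg in \<open>auto simp: k_def axis_def divide_nonneg_neg\<close>)
    also have "\<dots> = e \<bullet> g x0 + r * (h x0 - v + 1) - k"
      using neg x0(2) by (simp add: inner_add_right inner_diff_right inner_axis)
    finally show False unfolding k_def by linarith
  qed
  have r0: "0 \<le> r"
  proof (rule ccontr)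
    assume "\<not> 0 \<le> r"
    then have neg: "r < 0" by simp
    \<comment> \<open>The same device in the cost coordinate; the \<open>+ 1\<close> also keeps the
      added slack strictly positive, as \<open>W\<close> demands.\<close>
    define k where "k = \<bar>e \<bullet> g x0 + r * (h x0 - v)\<bar> + 1"
    have "0 \<le> l \<bullet> (y - A x0) + e \<bullet> g x0 + r * (h x0 - v + k / - r)"
      by (rule sep) (use x0 neg in \<open>auto simp: k_def divide_pos_neg\<close>)
    also have "\<dots> = e \<bullet> g x0 + r * (h x0 - v) - k"
      using neg x0(2) by (simp add: algebra_simps)
    finally show False unfolding k_def by linarith
  qed
  \<comment> \<open>This is where the constraint qualification enters. With \<open>r = 0\<close>,
    strict feasibility of \<open>x0\<close> forces \<open>e = 0\<close>, and \<open>core\<close>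
    then makes \<open>l\<close> vanish on all constraint values. So \<open>z\<close> is orthogonal
    to \<open>W\<close> while lying in its span, hence zero.\<close>
  have "r \<noteq> 0"
  proof
    assume r: "r = 0"
    have "0 \<le> e \<bullet> g x0"
      using sep[of x0 "g x0" "h x0 - v + 1"] x0 r by simp
    moreover have "e $ i * g x0 $ i \<le> 0" for i
      using e[of i] x0(3)[of i] by (simp add: mult_nonneg_nonpos)
    ultimately have "(\<Sum>i\<in>UNIV. e $ i * g x0 $ i) = 0"
      by (intro antisym sum_nonpos) (auto simp: inner_vec_def)
    then have "e $ i * g x0 $ i = 0" for i
      using \<open>\<And>i. e $ i * g x0 $ i \<le> 0\<close>
        sum_nonneg_eq_0_iff[of UNIV "\<lambda>i. - (e $ i * g x0 $ i)"] by (simp add: sum_negf)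
    then have "e = 0"
      using x0(3) by (metis less_irrefl mult_eq_0_iff vec_eq_iff zero_index)
    have ge: "0 \<le> l \<bullet> (y - A x)" if "x \<in> X" for x
      using sep[of x "g x" "h x - v + 1"] that r \<open>e = 0\<close> by simp
    have "l \<bullet> (y - A x) = 0" if x: "x \<in> X" for x
    proof -
      \<comment> \<open>Prolonging the segment from \<open>x\<close> beyond \<open>x0\<close>
        multiplies \<open>y - A x\<close> by the negative factor \<open>1 - t\<close>, so both signs
        of the pairing are nonnegative.\<close>
      obtain t where t: "t > 1" "(1 - t) *\<^sub>R x + t *\<^sub>R x0 \<in> X" using core[OF x] by blast
      have "y - A ((1 - t) *\<^sub>R x + t *\<^sub>R x0) = (1 - t) *\<^sub>R (y - A x)"
        using x0(2) by (simp add: linear_add[OF A] linear_diff[OF A] linear_cmul[OF A] algebra_simps)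
      then have "0 \<le> (1 - t) * (l \<bullet> (y - A x))" using ge[OF t(2)] by simp
      then show ?thesis using ge[OF x] t(1) by (simp add: zero_le_mult_iff)
    qed
    then have "orthogonal z w" if "w \<in> W" for w
      using that r \<open>e = 0\<close> unfolding W_def by (auto simp: zd orthogonal_def inner_prod_def)
    then have "orthogonal z z" using z(1) orthogonal_to_span by blast
    then show False using z(2) by (simp add: orthogonal_self)
  qed
  then have r: "0 < r" using r0 by simp
  show thesis
  proof (rule that[of "(1 / r) *\<^sub>R e" "(1 / r) *\<^sub>R l"])
    show "0 \<le> ((1 / r) *\<^sub>R e) $ i" for i using e r by simp
    fix x assume x: "x \<in> X"
    \<comment> \<open>\<open>h x - v\<close> itself is not an admissible cost coordinate, so it is
      approached from above by \<open>d\<close>.\<close>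
    have "0 \<le> (1 / r) * (l \<bullet> (y - A x) + e \<bullet> g x) + (h x - v) + d" if "0 < d" for d
    proof -
      have "0 \<le> l \<bullet> (y - A x) + e \<bullet> g x + r * (h x - v + d)"
        by (rule sep) (use x that in auto)
      then have "0 \<le> (1 / r) * (l \<bullet> (y - A x) + e \<bullet> g x + r * (h x - v + d))"
        using r by simp
      then show ?thesis using r by (simp add: field_simps)
    qed
    then have "0 \<le> (1 / r) * (l \<bullet> (y - A x) + e \<bullet> g x) + (h x - v)"
      by (rule field_le_epsilon)
    then show "v \<le> h x + ((1 / r) *\<^sub>R l) \<bullet> (y - A x) + ((1 / r) *\<^sub>R e) \<bullet> g x"
      by (simp add: algebra_simps)
  qed
qed

text \<open>Supplies the \<open>core\<close> hypothesis of \<open>slater_multipliers\<close> for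
  matrices: each row can be prolonged separately, and the smallest of the finitely many factors
  serves all rows.\<close>

lemma rows_rel_interior_prolong:
  fixes S :: "(real ^ 'n) set" and P Q :: "real ^ 'n ^ 'm"
  assumes "convex S" "\<And>i. P $ i \<in> rel_interior S" "\<And>i. Q $ i \<in> S"
  shows "\<exists>t>1. \<forall>i. ((1 - t) *\<^sub>R Q + t *\<^sub>R P) $ i \<in> S"
proof -
  have PS: "P $ i \<in> S" for i using assms(2) rel_interior_subset by blast
  have "\<forall>i. \<exists>t>1. (1 - t) *\<^sub>R Q $ i + t *\<^sub>R P $ i \<in> S"
    using assms(2,3) convex_rel_interior_iff[OF assms(1)] by (metis empty_iff)
  then obtain T where T: "\<And>i. 1 < T i" "\<And>i. (1 - T i) *\<^sub>R Q $ i + T i *\<^sub>R P $ i \<in> S" by metis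
  define t where "t = Min (range T)"
  have t: "1 < t" "\<And>i. t \<le> T i" using T(1) by (auto simp: t_def)
  have "(1 - t) *\<^sub>R Q $ i + t *\<^sub>R P $ i \<in> S" for i
  proof -
    \<comment> \<open>The prolongation by \<open>t\<close> is
      \<open>P $ i + (t - 1) *\<^sub>R (P $ i - Q $ i)\<close>; it divides the segment from
      \<open>P $ i\<close> to the prolongation by \<open>T i\<close> in the ratio given by
      \<open>k\<close>.\<close>
    define k where "k = (t - 1) / (T i - 1)"
    have k: "0 \<le> k" "k \<le> 1" "k * (T i - 1) = t - 1"
      using t(1) t(2)[of i] T(1)[of i] by (auto simp: k_def field_simps)
    have "(1 - k) *\<^sub>R P $ i + k *\<^sub>R ((1 - T i) *\<^sub>R Q $ i + T i *\<^sub>R P $ i) \<in> S"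
      using assms(1) PS T(2) k by (auto simp: convex_alt)
    also have "(1 - k) *\<^sub>R P $ i + k *\<^sub>R ((1 - T i) *\<^sub>R Q $ i + T i *\<^sub>R P $ i)
       = (- (k * (T i - 1))) *\<^sub>R Q $ i + (1 + k * (T i - 1)) *\<^sub>R P $ i"
      by (simp add: algebra_simps)
    finally show ?thesis unfolding k(3) by simp
  qed
  then show ?thesis using t(1) by auto
qed

text \<open>\<open>outer_sum\<close> is adjoint to the pair of marginal maps, so the marginal
  multipliers merge with \<open>C\<close> into one linear cost that splits by rows.\<close>

lemma inner_outer_sum:
  fixes Q :: "real ^ 'n ^ 'm"
  shows "Q \<bullet> outer_sum l m = l \<bullet> (Q *v 1) + m \<bullet> (transpose Q *v 1)"
proof -
  have "Q \<bullet> outer_sum l m = (\<Sum>i\<in>UNIV. \<Sum>j\<in>UNIV. l $ i * Q $ i $ j) + (\<Sum>i\<in>UNIV. \<Sum>j\<in>UNIV. m $ j * Q $ i $ j)"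
    by (simp add: inner_vec_def outer_sum_def algebra_simps sum.distrib)
  also have "(\<Sum>i\<in>UNIV. \<Sum>j\<in>UNIV. m $ j * Q $ i $ j) = (\<Sum>j\<in>UNIV. \<Sum>i\<in>UNIV. m $ j * Q $ i $ j)"
    by (rule sum.swap)
  finally show ?thesis
    by (simp add: inner_vec_def matrix_vector_mult_def transpose_def sum_distrib_left)
qed

section \<open>Calculus of a conjugate whose supremum is uniquely attained\<close>

locale uniquely_attained_conjugate =
  fixes \<psi> :: "'a::euclidean_space \<Rightarrow> ereal"
  assumes not_MInfty: "\<psi> q \<noteq> -\<infinity>"
    and unique_maximizer: "\<exists>!q. is_conjugate_maximizer \<psi> p q"
begin

abbreviation rpsi :: "'a \<Rightarrow> real" where "rpsi q \<equiv> real_of_ereal (\<psi> q)"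

lemma edomD: "q \<in> edom \<psi> \<Longrightarrow> \<psi> q = ereal (rpsi q)"
  using not_MInfty[of q] by (cases "\<psi> q") (auto simp: edom_def)

lemma ereal_minus_edom: "q \<in> edom \<psi> \<Longrightarrow> ereal x - \<psi> q = ereal (x - rpsi q)"
  using not_MInfty[of q] by (cases "\<psi> q") (auto simp: edom_def)

lemma grad_conjugate_maximizer: "is_conjugate_maximizer \<psi> p (grad_conjugate \<psi> p)"
  unfolding grad_conjugate_def arg_max_def using unique_maximizer[of p] by (blast intro: someI)

lemma grad_conjugate_in_edom: "grad_conjugate \<psi> p \<in> edom \<psi>"
  using grad_conjugate_maximizer[of p] by (simp add: is_arg_max_def)

lemma grad_conjugate_ge:
  assumes "q \<in> edom \<psi>"
  shows "p \<bullet> q - rpsi q \<le> p \<bullet> grad_conjugate \<psi> p - rpsi (grad_conjugate \<psi> p)"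
proof -
  have "\<not> ereal (p \<bullet> grad_conjugate \<psi> p) - \<psi> (grad_conjugate \<psi> p) < ereal (p \<bullet> q) - \<psi> q"
    using grad_conjugate_maximizer[of p] assms by (simp add: is_arg_max_def)
  then show ?thesis
    by (simp add: ereal_minus_edom assms grad_conjugate_in_edom not_less)
qed

text \<open>A tie would make \<open>q\<close> a second maximizer.\<close>

lemma grad_conjugate_gt:
  assumes "q \<in> edom \<psi>" "q \<noteq> grad_conjugate \<psi> p"
  shows "p \<bullet> q - rpsi q < p \<bullet> grad_conjugate \<psi> p - rpsi (grad_conjugate \<psi> p)"
proof (rule ccontr)
  assume "\<not> ?thesis"
  then have "p \<bullet> y - rpsi y \<le> p \<bullet> q - rpsi q" if "y \<in> edom \<psi>" for y
    using grad_conjugate_ge[OF that, of p] by linarith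
  then have "ereal (p \<bullet> y) - \<psi> y \<le> ereal (p \<bullet> q) - \<psi> q" if "y \<in> edom \<psi>" for y
    using that by (simp add: ereal_minus_edom assms(1))
  then have "is_conjugate_maximizer \<psi> p q"
    using assms(1) by (auto simp: is_arg_max_def not_less)
  then show False using assms(2) unique_maximizer[of p] grad_conjugate_maximizer[of p] by blast
qed

lemma conjugate_eq:
  "conjugate \<psi> p = ereal (p \<bullet> grad_conjugate \<psi> p - rpsi (grad_conjugate \<psi> p))"
  unfolding conjugate_def
proof (rule antisym)
  show "(SUP q\<in>edom \<psi>. ereal (p \<bullet> q) - \<psi> q) \<le> ereal (p \<bullet> grad_conjugate \<psi> p - rpsi (grad_conjugate \<psi> p))"
    by (rule SUP_least) (simp add: ereal_minus_edom grad_conjugate_ge)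
  show "ereal (p \<bullet> grad_conjugate \<psi> p - rpsi (grad_conjugate \<psi> p)) \<le> (SUP q\<in>edom \<psi>. ereal (p \<bullet> q) - \<psi> q)"
    by (rule SUP_upper2[OF grad_conjugate_in_edom[of p]])
      (simp add: ereal_minus_edom grad_conjugate_in_edom)
qed

text \<open>Fermat's rule: at an interior maximizer of \<open>p \<bullet> q - rpsi q\<close> the
  derivative vanishes.\<close>

lemma gradient_grad_conjugate:
  assumes k: "grad_conjugate \<psi> p \<in> interior (edom \<psi>)"
    and d: "rpsi differentiable_on interior (edom \<psi>)"
  shows "gradient rpsi (grad_conjugate \<psi> p) = p"
proof (rule gradient_eqI)
  let ?k = "grad_conjugate \<psi> p"
  obtain F where F: "(rpsi has_derivative F) (at ?k)"
    using d k at_within_open[OF k open_interior]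
    unfolding differentiable_on_def differentiable_def by auto
  have "((\<lambda>q. p \<bullet> q - rpsi q) has_derivative (\<lambda>h. p \<bullet> h - F h)) (at ?k)"
    by (auto intro!: derivative_intros F)
  then have "(\<lambda>h. p \<bullet> h - F h) = (\<lambda>h. 0)"
    using grad_conjugate_ge interior_subset
    by (intro differential_zero_maxmin[OF k open_interior]) auto
  then have "F = (\<lambda>h. h \<bullet> p)"
    by (auto simp: fun_eq_iff inner_commute)
  then show "GDERIV rpsi ?k :> p" using F by (simp add: gderiv_def)
qed

end

section \<open>The Lagrangian and its row-wise minimization\<close>

locale transport_problem = uniquely_attained_conjugate \<psi>
  for \<psi> :: "real ^ 'n::{finite,linorder} \<Rightarrow> ereal" +
  fixes C :: "real ^ 'n::{finite,linorder} ^ 'm" and a :: "real ^ 'm"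
    and b :: "real ^ 'n::{finite,linorder}" and \<xi> c :: real
  assumes dom_nonneg: "edom \<psi> \<subseteq> {q. \<forall>j. 0 \<le> q $ j}"
    and perplexity_finite: "\<psi> (perplexity_vec \<xi>) = ereal c"
begin

text \<open>The real-valued Lagrangian, grouped by rows of \<open>Q\<close> so that its minimization
  decouples; \<open>L_eq\<close> recovers the usual grouping by constraints.\<close>

definition L :: "real ^ 'n::{finite,linorder} ^ 'm \<Rightarrow> real ^ 'm \<Rightarrow> real ^ 'n::{finite,linorder} \<Rightarrow> real ^ 'm \<Rightarrow> real" where
  "L Q l m e = l \<bullet> a + m \<bullet> b
     + (\<Sum>i\<in>UNIV. e $ i * (rpsi (Q $ i) - c) - Q $ i \<bullet> (outer_sum l m - C) $ i)"

lemma L_eq: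
  "L Q l m e = Q \<bullet> C + l \<bullet> (a - Q *v 1) + m \<bullet> (b - transpose Q *v 1)
     + (\<Sum>i\<in>UNIV. e $ i * (rpsi (Q $ i) - c))"
proof -
  have "(\<Sum>i\<in>UNIV. Q $ i \<bullet> (outer_sum l m - C) $ i) = Q \<bullet> (outer_sum l m - C)"
    by (simp only: inner_vec_def[of Q])
  then show ?thesis
    unfolding L_def by (simp add: sum_subtractf inner_diff_right inner_outer_sum)
qed

text \<open>Factoring \<open>e $ i\<close> out of row \<open>i\<close> exposes the negated objective
  of the conjugate at the scaled row.\<close>

lemma L_eq_scaled:
  assumes "\<And>i. 0 < e $ i"
  shows "L Q l m e = l \<bullet> a + m \<bullet> b
    + (\<Sum>i\<in>UNIV. e $ i * (- (row_scale e (outer_sum l m - C) $ i \<bullet> Q $ i - rpsi (Q $ i)) - c))"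
proof -
  have "e $ i \<noteq> 0" for i using assms[of i] by simp
  then show ?thesis
    unfolding L_def row_scale_def by (simp add: algebra_simps inner_commute)
qed

lemma lagrangian_eq:
  assumes "\<And>i. Q $ i \<in> edom \<psi>"
  shows "lagrangian \<psi> C a b \<xi> Q l m e = ereal (L Q l m e)"
proof -
  have "ereal (e $ i) * (\<psi> (Q $ i) - \<psi> (perplexity_vec \<xi>)) = ereal (e $ i * (rpsi (Q $ i) - c))" for i
    using not_MInfty[of "Q $ i"] assms[of i] perplexity_finite by (cases "\<psi> (Q $ i)") (auto simp: edom_def)
  then show ?thesis unfolding lagrangian_def L_eq by simp
qed

text \<open>The minimizer of the Lagrangian for positive \<open>e\<close>, unique by
  \<open>L_G_less\<close>.\<close>

abbreviation G :: "real ^ 'm \<Rightarrow> real ^ 'n::{finite,linorder} \<Rightarrow> real ^ 'm \<Rightarrow> real ^ 'n::{finite,linorder} ^ 'm" where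
  "G l m e \<equiv> grad_conjugate_rows \<psi> (row_scale e (outer_sum l m - C))"

lemma G_in_edom: "G l m e $ i \<in> edom \<psi>"
  by (simp add: grad_conjugate_rows_def grad_conjugate_in_edom)

lemma L_G_le:
  assumes e: "\<And>i. 0 < e $ i" and Q: "\<And>i. Q $ i \<in> edom \<psi>"
  shows "L (G l m e) l m e \<le> L Q l m e"
  unfolding L_eq_scaled[OF e] grad_conjugate_rows_def
proof (intro add_left_mono sum_mono mult_left_mono diff_right_mono le_imp_neg_le)
  show "0 \<le> e $ i" for i using e[of i] by simp
qed (use grad_conjugate_ge[OF Q] in simp)

text \<open>No row can do better than the corresponding row of \<open>G\<close>, and a row that
  differs does strictly worse since its weight is positive.\<close>

lemma L_G_less:
  assumes e: "\<And>i. 0 < e $ i" and Q: "\<And>i. Q $ i \<in> edom \<psi>" and ne: "Q \<noteq> G l m e"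
  shows "L (G l m e) l m e < L Q l m e"
proof -
  obtain k where k: "Q $ k \<noteq> G l m e $ k" using ne by (auto simp: vec_eq_iff[of Q])
  show ?thesis
    unfolding L_eq_scaled[OF e] grad_conjugate_rows_def
  proof (intro add_strict_left_mono sum_strict_mono_ex1 ballI bexI[of _ k])
    show "e $ i * (- (row_scale e (outer_sum l m - C) $ i \<bullet> (\<chi> i. grad_conjugate \<psi> (row_scale e (outer_sum l m - C) $ i)) $ i
        - rpsi ((\<chi> i. grad_conjugate \<psi> (row_scale e (outer_sum l m - C) $ i)) $ i)) - c)
      \<le> e $ i * (- (row_scale e (outer_sum l m - C) $ i \<bullet> Q $ i - rpsi (Q $ i)) - c)" for i
      using grad_conjugate_ge[OF Q, of _ i] less_imp_le[OF e]
      by (intro mult_left_mono diff_right_mono le_imp_neg_le) simp_all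
  next
    show "e $ k * (- (row_scale e (outer_sum l m - C) $ k \<bullet> (\<chi> i. grad_conjugate \<psi> (row_scale e (outer_sum l m - C) $ i)) $ k
        - rpsi ((\<chi> i. grad_conjugate \<psi> (row_scale e (outer_sum l m - C) $ i)) $ k)) - c)
      < e $ k * (- (row_scale e (outer_sum l m - C) $ k \<bullet> Q $ k - rpsi (Q $ k)) - c)"
      using grad_conjugate_gt[OF Q[of k], of "row_scale e (outer_sum l m - C) $ k"] k e[of k]
      by (simp add: grad_conjugate_rows_def mult_strict_left_mono)
  qed auto
qed

lemma lagrange_domain: "{Q. nonneg_mat Q \<and> (\<forall>i. Q $ i \<in> edom \<psi>)} = {Q :: real ^ 'n::{finite,linorder} ^ 'm. \<forall>i. Q $ i \<in> edom \<psi>}"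
  using dom_nonneg by (auto simp: nonneg_mat_def)

lemma lagrange_dual_geI:
  assumes "\<And>Q. (\<And>i. Q $ i \<in> edom \<psi>) \<Longrightarrow> v \<le> L Q l m e"
  shows "ereal v \<le> lagrange_dual \<psi> C a b \<xi> l m e"
  unfolding lagrange_dual_def lagrange_domain
  by (rule INF_greatest) (use assms in \<open>simp add: lagrangian_eq\<close>)

lemma lagrange_dual_le:
  assumes "\<And>i. Q $ i \<in> edom \<psi>"
  shows "lagrange_dual \<psi> C a b \<xi> l m e \<le> ereal (L Q l m e)"
  unfolding lagrange_dual_def lagrange_domain
  by (rule INF_lower2[of Q]) (use assms in \<open>simp_all add: lagrangian_eq\<close>)

lemma lagrange_dual_eq:
  assumes "\<And>i. 0 < e $ i"
  shows "lagrange_dual \<psi> C a b \<xi> l m e = ereal (L (G l m e) l m e)"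
  by (intro antisym lagrange_dual_le lagrange_dual_geI L_G_le G_in_edom assms)

text \<open>Links the two dual problems, which range over \<open>e > 0\<close> and
  \<open>e \<ge> 0\<close> respectively: on the smaller set their objectives agree.\<close>

lemma dual_objective_eq_lagrange_dual:
  assumes "\<And>i. 0 < e $ i"
  shows "dual_objective \<psi> C a b \<xi> l m e = lagrange_dual \<psi> C a b \<xi> l m e"
  unfolding lagrange_dual_eq[OF assms] L_eq_scaled[OF assms] dual_objective_def
  by (simp add: conjugate_eq perplexity_finite grad_conjugate_rows_def)

section \<open>Strong duality and complementary slackness\<close>

lemma feasibleD:
  assumes "Q \<in> transport_polytope a b \<inter> entropy_ball \<psi> \<xi>"
  shows "Q *v 1 = a" "transpose Q *v 1 = b" "Q $ i \<in> edom \<psi>" "rpsi (Q $ i) \<le> c"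
proof -
  have "\<psi> (Q $ i) \<le> ereal c" using assms by (simp add: entropy_ball_def perplexity_finite)
  moreover from this show "Q $ i \<in> edom \<psi>"
    by (cases "\<psi> (Q $ i)") (auto simp: edom_def)
  ultimately show "rpsi (Q $ i) \<le> c" using edomD[of "Q $ i"] by (metis ereal_less_eq(3))
qed (use assms in \<open>auto simp: transport_polytope_def\<close>)

lemma feasibleI:
  assumes "Q *v 1 = a" "transpose Q *v 1 = b" "\<And>i. Q $ i \<in> edom \<psi>" "\<And>i. rpsi (Q $ i) \<le> c"
  shows "Q \<in> transport_polytope a b \<inter> entropy_ball \<psi> \<xi>"
proof -
  have "\<psi> (Q $ i) \<le> ereal c" for i
    using edomD[OF assms(3)[of i]] assms(4)[of i] by (metis ereal_less_eq(3))
  moreover have "nonneg_mat Q" using assms(3) dom_nonneg by (auto simp: nonneg_mat_def)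
  ultimately show ?thesis using assms by (simp add: transport_polytope_def entropy_ball_def perplexity_finite)
qed

lemma L_feasible:
  assumes "Q \<in> transport_polytope a b \<inter> entropy_ball \<psi> \<xi>"
  shows "L Q l m e = Q \<bullet> C + (\<Sum>i\<in>UNIV. e $ i * (rpsi (Q $ i) - c))"
  unfolding L_eq feasibleD(1,2)[OF assms] by simp

text \<open>The chain \<open>P \<bullet> C \<le> L (G l m e) l m e \<le> L P l m e \<le> P \<bullet>
  C\<close> collapses. Uniqueness of the minimizer gives the first claim; the second holds because
  nonpositive terms with sum zero all vanish and \<open>e\<close> is positive.\<close>

lemma strong_duality_imp:
  assumes P: "P \<in> transport_polytope a b \<inter> entropy_ball \<psi> \<xi>"
    and e: "\<And>i. 0 < e $ i" and le: "ereal (P \<bullet> C) \<le> lagrange_dual \<psi> C a b \<xi> l m e"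
  shows "P = G l m e" "rpsi (P $ i) = c"
proof -
  have le': "P \<bullet> C \<le> L (G l m e) l m e" using le lagrange_dual_eq[OF e] by simp
  have t: "e $ i * (rpsi (P $ i) - c) \<le> 0" for i
    using feasibleD(4)[OF P, of i] e[of i] by (simp add: mult_nonneg_nonpos)
  then have "(\<Sum>i\<in>UNIV. e $ i * (rpsi (P $ i) - c)) \<le> 0" by (intro sum_nonpos) auto
  then have "L P l m e \<le> P \<bullet> C" by (simp add: L_feasible[OF P])
  then show PG: "P = G l m e"
    using L_G_less[OF e feasibleD(3)[OF P]] le' by fastforce
  have "0 \<le> (\<Sum>i\<in>UNIV. e $ i * (rpsi (P $ i) - c))"
    using le' unfolding PG[symmetric] by (simp add: L_feasible[OF P])
  then have "e $ i * (rpsi (P $ i) - c) = 0"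
    using t sum_nonneg_eq_0_iff[of UNIV "\<lambda>i. - (e $ i * (rpsi (P $ i) - c))"]
      \<open>(\<Sum>i\<in>UNIV. e $ i * (rpsi (P $ i) - c)) \<le> 0\<close> by (simp add: sum_negf)
  then show "rpsi (P $ i) = c" using e[of i] by simp
qed

text \<open>Applies \<open>slater_multipliers\<close> to the product of the row domains, with the
  two marginals as the linear map and \<open>rpsi (Q $ i) - c\<close> as the inequality
  constraints.\<close>

lemma strong_duality:
  assumes conv: "convex_on (edom \<psi>) rpsi"
    and sf: "strictly_feasible \<psi> a b \<xi>"
    and P: "is_arg_min (\<lambda>Q. Q \<bullet> C) (\<lambda>Q. Q \<in> transport_polytope a b \<inter> entropy_ball \<psi> \<xi>) P"
  obtains l m e where "\<And>i. 0 \<le> e $ i" "ereal (P \<bullet> C) \<le> lagrange_dual \<psi> C a b \<xi> l m e"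
proof -
  let ?X = "{Q :: real ^ 'n::{finite,linorder} ^ 'm. \<forall>i. Q $ i \<in> edom \<psi>}"
  let ?A = "\<lambda>Q :: real ^ 'n::{finite,linorder} ^ 'm. (Q *v 1, transpose Q *v 1)"
  let ?g = "\<lambda>Q :: real ^ 'n::{finite,linorder} ^ 'm. \<chi> i. rpsi (Q $ i) - c"
  obtain P0 where P0: "P0 \<in> transport_polytope a b" "\<And>i. P0 $ i \<in> rel_interior (edom \<psi>)"
    "\<And>i. \<psi> (P0 $ i) < ereal c"
    using sf unfolding strictly_feasible_def perplexity_finite by auto
  have P0e: "P0 $ i \<in> edom \<psi>" for i using P0(2) rel_interior_subset by blast
  have cv: "convex (edom \<psi>)" using conv by (rule convex_on_imp_convex)
  have cX: "convex ?X" using cv by (auto simp: convex_alt)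
  have convex_cost: "convex_on ?X (\<lambda>Q. Q \<bullet> C)"
    using cX by (auto simp: convex_on_def inner_add_left)
  have convex_constraint: "convex_on ?X (\<lambda>Q. ?g Q $ i)" for i
    unfolding convex_on_def
  proof (intro conjI cX ballI allI impI)
    fix Q R :: "real ^ 'n::{finite,linorder} ^ 'm" and u v :: real
    assume QR: "Q \<in> ?X" "R \<in> ?X" and uv: "0 \<le> u" "0 \<le> v" "u + v = 1"
    have "rpsi (u *\<^sub>R Q $ i + v *\<^sub>R R $ i) \<le> u * rpsi (Q $ i) + v * rpsi (R $ i)"
      using conv QR uv by (simp add: convex_on_def)
    moreover have "c = u * c + v * c" using uv by (metis distrib_right mult_1)
    ultimately show "?g (u *\<^sub>R Q + v *\<^sub>R R) $ i \<le> u * ?g Q $ i + v * ?g R $ i"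
      by (simp add: algebra_simps)
  qed
  have linear: "linear ?A"
    by (rule linearI) (simp_all add: matrix_vector_mult_def transpose_def vec_eq_iff sum.distrib sum_distrib_left)
  have P0X: "P0 \<in> ?X" using P0e by simp
  have P0A: "?A P0 = (a, b)" using P0(1) by (simp add: transport_polytope_def)
  have P0g: "?g P0 $ i < 0" for i
  proof -
    have "ereal (rpsi (P0 $ i)) < ereal c" using P0(3)[of i] edomD[OF P0e[of i]] by metis
    then show ?thesis by simp
  qed
  have core: "\<exists>t>1. (1 - t) *\<^sub>R Q + t *\<^sub>R P0 \<in> ?X" if "Q \<in> ?X" for Q
    using rows_rel_interior_prolong[OF cv P0(2), of Q] that by auto
  have opt: "P \<bullet> C \<le> Q \<bullet> C" if "Q \<in> ?X" "?A Q = (a, b)" "\<And>i. ?g Q $ i \<le> 0" for Q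
  proof -
    have "Q \<in> transport_polytope a b \<inter> entropy_ball \<psi> \<xi>"
    proof (rule feasibleI)
      show "rpsi (Q $ i) \<le> c" for i using that(3)[of i] by simp
    qed (use that(1,2) in auto)
    then show ?thesis using P by (simp add: is_arg_min_def) (meson not_less)
  qed
  obtain y e where e: "\<And>i. 0 \<le> e $ i"
    and dual: "\<And>Q. Q \<in> ?X \<Longrightarrow> P \<bullet> C \<le> Q \<bullet> C + y \<bullet> ((a, b) - ?A Q) + e \<bullet> ?g Q"
    by (rule slater_multipliers[where X = ?X and A = ?A and g = ?g,
          OF convex_cost convex_constraint linear P0X P0A P0g core opt]) (assumption | rule that)+
  obtain l m where y: "y = (l, m)" by (cases y)
  have "P \<bullet> C \<le> L Q l m e" if "\<And>i. Q $ i \<in> edom \<psi>" for Q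
    using dual[of Q] that by (simp add: L_eq y inner_prod_def inner_vec_def[of e])
  then show thesis using that[OF e] lagrange_dual_geI by blast
qed

section \<open>Bregman projection as regularized transport\<close>

lemma bregman_div_eq:
  assumes Q: "\<And>i. Q $ i \<in> edom \<psi>"
    and d: "rpsi differentiable_on interior (edom \<psi>)"
    and K: "K = grad_conjugate_rows \<psi> (- (1 / \<sigma>) *\<^sub>R C)" "\<And>i. K $ i \<in> interior (edom \<psi>)"
  shows "bregman_div \<psi> Q K
    = ereal ((\<Sum>i\<in>UNIV. rpsi (Q $ i)) + (Q \<bullet> C) / \<sigma> - ((\<Sum>i\<in>UNIV. rpsi (K $ i)) + (K \<bullet> C) / \<sigma>))"
proof -
  have Ke: "K $ i \<in> edom \<psi>" for i using K(2) interior_subset by blast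
  have sum: "(\<Sum>i\<in>UNIV. \<psi> (R $ i)) = ereal (\<Sum>i\<in>UNIV. rpsi (R $ i))"
    if "\<And>i. R $ i \<in> edom \<psi>" for R :: "real ^ 'n::{finite,linorder} ^ 'm"
  proof -
    have "(\<Sum>i\<in>UNIV. \<psi> (R $ i)) = (\<Sum>i\<in>UNIV. ereal (rpsi (R $ i)))"
      by (rule sum.cong[OF refl edomD[OF that]])
    then show ?thesis by simp
  qed
  \<comment> \<open>The rows of \<open>K\<close> being interior points is what lets
    \<open>gradient_grad_conjugate\<close> identify the gradient.\<close>
  have "gradient rpsi (K $ i) = (- (1 / \<sigma>) *\<^sub>R C) $ i" for i
    using gradient_grad_conjugate[OF _ d] K(2)[of i] unfolding K(1) grad_conjugate_rows_def by simp
  then have "(\<chi> i. gradient rpsi (K $ i)) = - (1 / \<sigma>) *\<^sub>R C"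
    by (simp add: vec_eq_iff)
  then show ?thesis
    unfolding bregman_div_def sum[OF Q] sum[OF Ke]
    by (simp add: inner_diff_left diff_divide_distrib)
qed

text \<open>Comparing \<open>P\<close> strictly with every other feasible point yields minimality
  and uniqueness at once.\<close>

lemma bregman_proj_eq:
  assumes P: "P \<in> transport_polytope a b \<inter> entropy_ball \<psi> \<xi>"
    and e: "\<And>i. 0 < e $ i" and le: "ereal (P \<bullet> C) \<le> lagrange_dual \<psi> C a b \<xi> l m e"
    and d: "rpsi differentiable_on interior (edom \<psi>)"
    and s: "0 < \<sigma>" "\<And>i. \<sigma> \<le> e $ i"
    and K: "K = grad_conjugate_rows \<psi> (- (1 / \<sigma>) *\<^sub>R C)" "\<And>i. K $ i \<in> interior (edom \<psi>)"
  shows "bregman_proj \<psi> (transport_polytope a b \<inter> entropy_ball \<psi> \<xi>) K = {P}"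
proof -
  let ?E = "transport_polytope a b \<inter> entropy_ball \<psi> \<xi>"
  note att = strong_duality_imp[OF P e le]
  have less: "bregman_div \<psi> P K < bregman_div \<psi> Q K" if Q: "Q \<in> ?E" "Q \<noteq> P" for Q
  proof -
    have "P \<bullet> C = L P l m e" by (simp add: L_feasible[OF P] att(2))
    also have "\<dots> < L Q l m e"
      using L_G_less[OF e feasibleD(3)[OF Q(1)]] Q(2) att(1) by metis
    \<comment> \<open>Feasibility makes \<open>rpsi (Q $ i) - c\<close> nonpositive, so shrinking
      its weight from \<open>e $ i\<close> to \<open>\<sigma>\<close> can only increase the
      sum.\<close>
    also have "\<dots> \<le> Q \<bullet> C + (\<Sum>i\<in>UNIV. \<sigma> * (rpsi (Q $ i) - c))"
      unfolding L_feasible[OF Q(1)]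
      using feasibleD(4)[OF Q(1)] s(2) by (intro add_left_mono sum_mono mult_right_mono_neg) auto
    also have "\<dots> = Q \<bullet> C + \<sigma> * (\<Sum>i\<in>UNIV. rpsi (Q $ i) - c)"
      by (simp only: sum_distrib_left)
    finally have "P \<bullet> C / \<sigma> < Q \<bullet> C / \<sigma> + (\<Sum>i\<in>UNIV. rpsi (Q $ i) - c)"
      using s(1) by (simp add: field_simps)
    \<comment> \<open>All constraints are tight at \<open>P\<close>, so the sum of the constants
      \<open>c\<close> is the entropy term of \<open>P\<close>.\<close>
    then show ?thesis
      unfolding bregman_div_eq[OF feasibleD(3)[OF P] d K] bregman_div_eq[OF feasibleD(3)[OF Q(1)] d K]
      by (simp add: att(2) sum_subtractf)
  qed
  show ?thesis
    unfolding bregman_proj_def is_arg_min_def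
  proof (intro equalityI subsetI)
    fix Q assume "Q \<in> {Q. Q \<in> ?E \<and> (\<nexists>R. R \<in> ?E \<and> bregman_div \<psi> R K < bregman_div \<psi> Q K)}"
    then show "Q \<in> {P}" using less P by blast
  next
    have "\<not> bregman_div \<psi> R K < bregman_div \<psi> P K" if "R \<in> ?E" for R
      using less[OF that] by (cases "R = P") auto
    moreover fix Q assume "Q \<in> {P}"
    ultimately show "Q \<in> {Q. Q \<in> ?E \<and> (\<nexists>R. R \<in> ?E \<and> bregman_div \<psi> R K < bregman_div \<psi> Q K)}"
      using P by blast
  qed
qed

end

section \<open>Finiteness of the threshold and conclusion\<close>

text \<open>
  If \<open>\<psi>(e\<^sub>\<xi>) = \<infinity>\<close>, then a positive multiplier makes the dual \<open>-\<infinity>\<close>, while its value at \<open>0\<close> is \<open>\<ge> 0\<close>.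
\<close>

lemma optimal_multipliers_pos_imp_finite:
  fixes \<psi> :: "real ^ 'n::{finite,linorder} \<Rightarrow> ereal" and C :: "real ^ 'n::{finite,linorder} ^ 'm"
  assumes not_MInfty: "\<And>q. \<psi> q \<noteq> -\<infinity>" and C: "nonneg_mat C" and sf: "strictly_feasible \<psi> a b \<xi>"
    and opt: "(l, m, e) \<in> optimal_multipliers \<psi> C a b \<xi>" and e: "\<And>i. 0 < e $ i"
  obtains c where "\<psi> (perplexity_vec \<xi>) = ereal c"
proof (cases "\<psi> (perplexity_vec \<xi>)")
  case PInf
  obtain P where P: "P \<in> transport_polytope a b" "\<And>i. P $ i \<in> rel_interior (edom \<psi>)"
    using sf unfolding strictly_feasible_def by auto
  then have "P $ i \<in> edom \<psi>" for i using rel_interior_subset by blast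
  then have fin: "\<bar>\<psi> (P $ i)\<bar> \<noteq> \<infinity>" for i
    using not_MInfty[of "P $ i"] by (cases "\<psi> (P $ i)") (auto simp: edom_def)
  have "ereal (e $ i) * (\<psi> (P $ i) - \<psi> (perplexity_vec \<xi>)) = -\<infinity>" for i
    using fin[of i] e[of i] PInf by (cases "\<psi> (P $ i)") auto
  \<comment> \<open>The sum is infinite but not \<open>\<infinity>\<close>, hence
    \<open>-\<infinity>\<close>.\<close>
  then have "\<bar>\<Sum>i\<in>UNIV. ereal (e $ i) * (\<psi> (P $ i) - \<psi> (perplexity_vec \<xi>))\<bar> = \<infinity>"
    and "(\<Sum>i\<in>UNIV. ereal (e $ i) * (\<psi> (P $ i) - \<psi> (perplexity_vec \<xi>))) \<noteq> \<infinity>"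
    by (simp_all only: sum_Inf sum_Pinfty) auto
  then have "lagrangian \<psi> C a b \<xi> P l m e = -\<infinity>"
    unfolding lagrangian_def by auto
  then have "lagrange_dual \<psi> C a b \<xi> l m e \<le> -\<infinity>"
    unfolding lagrange_dual_def using P(1) \<open>\<And>i. P $ i \<in> edom \<psi>\<close>
    by (intro INF_lower2[of P]) (auto simp: transport_polytope_def)
  also have "-\<infinity> < (0::ereal)" by simp
  also have "0 \<le> lagrange_dual \<psi> C a b \<xi> 0 0 0"
    unfolding lagrange_dual_def lagrangian_def
  proof (rule INF_greatest)
    fix Q :: "real ^ 'n::{finite,linorder} ^ 'm" assume "Q \<in> {Q. nonneg_mat Q \<and> (\<forall>i. Q $ i \<in> edom \<psi>)}"
    then have "0 \<le> Q \<bullet> C" using C unfolding inner_vec_def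
      by (auto intro!: sum_nonneg simp: nonneg_mat_def)
    \<comment> \<open>The convention that 0 times an infinite value is 0 removes the constraint
      terms, although each difference is \<open>-\<infinity>\<close>.\<close>
    then show "0 \<le> ereal (Q \<bullet> C + 0 \<bullet> (a - Q *v 1) + 0 \<bullet> (b - transpose Q *v 1))
      + (\<Sum>i\<in>UNIV. ereal (0 $ i) * (\<psi> (Q $ i) - \<psi> (perplexity_vec \<xi>)))"
      by (simp add: zero_ereal_def[symmetric])
  qed
  finally show ?thesis using opt
    by (simp add: optimal_multipliers_def is_arg_max_def) (metis order_refl zero_index)
qed (use not_MInfty that in auto)

text \<open>The conjugate is evaluated at \<open>outer_sum lam mu - C\<close>, the sign dictated by
  minimizing the Lagrangian. The rows of \<open>K\<close> are taken in the interior of the domain,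
  where differentiability is assumed. The last conjunct covers every dual solution, not only the
  given multipliers.\<close>

theorem proposition2:
  fixes \<psi> :: "real ^ 'n::{finite,linorder} \<Rightarrow> ereal"
    and C P :: "real ^ 'n::{finite,linorder} ^ 'm"
    and a lam eps :: "real ^ 'm"
    and b mu :: "real ^ 'n::{finite,linorder}"
    and \<xi> :: real
  assumes "\<And>q. \<psi> q \<noteq> -\<infinity>"
    and "edom \<psi> \<subseteq> {q. \<forall>j. 0 \<le> q $ j}"
    and "convex_on (edom \<psi>) (\<lambda>q. real_of_ereal (\<psi> q))"
    and "strictly_convex_on (interior (edom \<psi>)) (\<lambda>q. real_of_ereal (\<psi> q))"
    and "(\<lambda>q. real_of_ereal (\<psi> q)) differentiable_on interior (edom \<psi>)"
    and "\<And>p. \<exists>!q. is_conjugate_maximizer \<psi> p q"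
    and "nonneg_mat C"
    and "a \<in> prob_simplex" and "b \<in> prob_simplex" and "0 < \<xi>"
    and "strictly_feasible \<psi> a b \<xi>"
    and "is_arg_min (\<lambda>Q. Q \<bullet> C) (\<lambda>Q. Q \<in> transport_polytope a b \<inter> entropy_ball \<psi> \<xi>) P"
    and "(lam, mu, eps) \<in> optimal_multipliers \<psi> C a b \<xi>"
    and "\<forall>i. 0 < eps $ i"
  shows "(\<forall>\<sigma> K. 0 < \<sigma> \<and> \<sigma> \<le> Min (range (\<lambda>i. eps $ i)) \<and>
            K = grad_conjugate_rows \<psi> (- (1 / \<sigma>) *\<^sub>R C) \<and>
            (\<forall>i. K $ i \<in> interior (edom \<psi>)) \<longrightarrow>
            bregman_proj \<psi> (transport_polytope a b \<inter> entropy_ball \<psi> \<xi>) K = {P})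
       \<and> P = grad_conjugate_rows \<psi> (row_scale eps (outer_sum lam mu - C))
       \<and> (lam, mu, eps) \<in> dual_solutions \<psi> C a b \<xi>
       \<and> (\<forall>(l, m, e) \<in> dual_solutions \<psi> C a b \<xi>.
            P = grad_conjugate_rows \<psi> (row_scale e (outer_sum l m - C)))"
proof -
  obtain c where c: "\<psi> (perplexity_vec \<xi>) = ereal c"
    using optimal_multipliers_pos_imp_finite[OF assms(1,7,11,13)] assms(14) by blast
  interpret transport_problem \<psi> C a b \<xi> c
    by unfold_locales (use assms(1,2,6) c in auto)
  let ?E = "transport_polytope a b \<inter> entropy_ball \<psi> \<xi>"
  let ?d = "lagrange_dual \<psi> C a b \<xi>"
  have P: "P \<in> ?E" using assms(12) by (simp add: is_arg_min_def)
  have max: "?d l m e \<le> ?d lam mu eps" if "\<And>i. 0 \<le> e $ i" for l m e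
    using assms(13) that by (simp add: optimal_multipliers_def is_arg_max_def not_less) blast
  obtain l m e where "\<And>i. 0 \<le> e $ i" "ereal (P \<bullet> C) \<le> ?d l m e"
    using strong_duality[OF assms(3,11,12)] by metis
  \<comment> \<open>Some multipliers close the duality gap, so the optimal ones close it
    too.\<close>
  then have le: "ereal (P \<bullet> C) \<le> ?d lam mu eps" using max order_trans by blast
  have eps: "0 < eps $ i" for i using assms(14) by simp
  \<comment> \<open>A maximum over \<open>e \<ge> 0\<close> attained at a positive
    \<open>eps\<close> is also a maximum over \<open>e > 0\<close>, where both objectives
    coincide.\<close>
  have "dual_objective \<psi> C a b \<xi> l m e \<le> dual_objective \<psi> C a b \<xi> lam mu eps"
    if "\<forall>i. 0 < e $ i" for l m e
    using max[of e l m] that eps by (simp add: dual_objective_eq_lagrange_dual less_imp_le)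
  then have "(lam, mu, eps) \<in> dual_solutions \<psi> C a b \<xi>"
    using eps by (auto simp: dual_solutions_def is_arg_max_def) (meson leD)
  moreover have "P = G l m e" if "(l, m, e) \<in> dual_solutions \<psi> C a b \<xi>" for l m e
  proof -
    have e: "0 < e $ i" for i
      using that by (simp add: dual_solutions_def is_arg_max_def)
    \<comment> \<open>Any dual solution has at least the value at \<open>eps\<close>, so it closes
      the gap as well and determines \<open>P\<close>.\<close>
    have "dual_objective \<psi> C a b \<xi> lam mu eps \<le> dual_objective \<psi> C a b \<xi> l m e"
      using that eps by (simp add: dual_solutions_def is_arg_max_def) (meson not_less)
    then have "?d lam mu eps \<le> ?d l m e"
      using eps e by (simp add: dual_objective_eq_lagrange_dual)
    then show ?thesis using strong_duality_imp(1)[OF P e] le order_trans by blast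
  qed
  moreover have "bregman_proj \<psi> ?E K = {P}"
    if "0 < \<sigma> \<and> \<sigma> \<le> Min (range (\<lambda>i. eps $ i)) \<and>
      K = grad_conjugate_rows \<psi> (- (1 / \<sigma>) *\<^sub>R C) \<and> (\<forall>i. K $ i \<in> interior (edom \<psi>))" for \<sigma> K
    using that by (intro bregman_proj_eq[OF P eps le assms(5)]) auto
  ultimately show ?thesis by blast
qed

end
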